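(* Let $\mathcal S,\mathcal B\subset\mathbb R^p$ be bounded closed convex polytopes with non-empty interior. The outer approximation algorithm with initial approximation $\mathcal S$, using a weak point separating oracle $\mathsf{ptO}^*(\mathcal B)$ for $\mathcal B$, terminates with the polytope $\mathcal R=\mathcal B\cap\mathcal S$. The algorithm makes at most $v+2^f$ oracle calls, where $v$ is the number of vertices of $\mathcal R$ and $f$ is the number of facets of $\mathcal B$.
   Context: A halfspace in $\mathbb R^p$ is a set $H=\{y\in\mathbb R^p: yh\ge M\}$, where $h\in\mathbb R^p$ is a non-null vector, $M\in\mathbb R$, and $yh$ is the inner product. The halfspace $H$ is supporting for $\mathcal B$ if it contains $\mathcal B$ and there is a boundary point of $\mathcal B$ on the boundary of $H$. A facet of a full-dimensional polytope in $\mathbb R^p$ is a face of dimension $p-1$. Weak point separating oracle $\mathsf{ptO}^*(\mathcal B)$: a black box which fixes, once and for all, an internal point $o$ of $\mathcal B$. On input a point $v\in\mathbb R^p$ it returns "inside" if $v\in\mathcal B$; otherwise it connects $v$ to $o$ by a line segment, computes the point where this segment intersects the boundary of $\mathcal B$, and returns a supporting halfspace $H$ of $\mathcal B$ whose boundary touches $\mathcal B$ at that point (any such supporting halfspace is an allowed answer). Outer approximation algorithm: Set $\mathcal S_0=\mathcal S$. In each approximating polytope certain vertices are marked "final"; initially no vertex is marked. Consider the $i$-th approximation $\mathcal S_i$. If all vertices of $\mathcal S_i$ are marked final, stop with result $\mathcal R=\mathcal S_i$. Otherwise pick any non-final vertex $v_i$ of $\mathcal S_i$ and call the oracle with the point $v_i$.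 If the oracle returns "inside", mark $v_i$ as final and repeat. Otherwise the oracle returns a halfspace $H$; let $\mathcal S_{i+1}=\mathcal S_i\cap H$, keep the "final" flag on previous vertices, and repeat. The statement holds for every choice of the picked vertices and for all admissible oracle answers. *)

theory Defs
  imports "HOL-Analysis.Analysis"
begin

definition halfspace :: "'a::euclidean_space set \<Rightarrow> bool" where
  "halfspace H \<longleftrightarrow> (\<exists>h M. h \<noteq> 0 \<and> H = {y. y \<bullet> h \<ge> M})"

definition supporting_halfspace :: "'a::euclidean_space set \<Rightarrow> 'a set \<Rightarrow> bool" where
  "supporting_halfspace B H \<longleftrightarrow> halfspace H \<and> B \<subseteq> H \<and> frontier B \<inter> frontier H \<noteq> {}"

definition vertices :: "'a::euclidean_space set \<Rightarrow> 'a set" where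
  "vertices P = {x. x extreme_point_of P}"

definition facets :: "'a::euclidean_space set \<Rightarrow> 'a set set" where
  "facets P = {F. F facet_of P}"

datatype 'a answer = Inside | Halfspace "'a set"

text \<open>
  The oracle is modelled by the relation between queries and admissible answers; z is its fixed
  internal point. When B is convex and closed and z is interior to B, the point x of the second
  rule is uniquely determined by v.
\<close>

inductive weak_pt_oracle ::
  "'a::euclidean_space set \<Rightarrow> 'a \<Rightarrow> 'a \<Rightarrow> 'a answer \<Rightarrow> bool" for B z where
  inside: "v \<in> B \<Longrightarrow> weak_pt_oracle B z v Inside"
| outside: "\<lbrakk>v \<notin> B; x \<in> closed_segment v z; x \<in> frontier B;
      supporting_halfspace B H; x \<in> frontier H\<rbrakk>
    \<Longrightarrow> weak_pt_oracle B z v (Halfspace H)"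

text \<open>
  A state consists of the current approximation and the set of points marked final.
  Every step makes exactly one oracle call, so the number of steps counts the calls.
\<close>

type_synonym 'a state = "'a set \<times> 'a set"

inductive oa_step ::
  "'a::euclidean_space set \<Rightarrow> 'a \<Rightarrow> 'a state \<Rightarrow> 'a state \<Rightarrow> bool" for B z where
  mark: "\<lbrakk>v \<in> vertices P; v \<notin> F; weak_pt_oracle B z v Inside\<rbrakk>
    \<Longrightarrow> oa_step B z (P, F) (P, insert v F)"
| cut: "\<lbrakk>v \<in> vertices P; v \<notin> F; weak_pt_oracle B z v (Halfspace H)\<rbrakk>
    \<Longrightarrow> oa_step B z (P, F) (P \<inter> H, F)"

definition oa_init :: "'a::euclidean_space set \<Rightarrow> 'a state" where
  "oa_init S = (S, {})"

definition oa_stopped :: "'a::euclidean_space state \<Rightarrow> bool" where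
  "oa_stopped s \<longleftrightarrow> vertices (fst s) \<subseteq> snd s"

end

theory Submission
  imports Defs
begin

text \<open>
  A cut at a boundary point \<open>x\<close> of \<open>B\<close> exhausts a whole face of \<open>B\<close>.  The supporting hyperplane
  meets \<open>B\<close> in a nonempty proper face, and such a face of a polytope is the intersection of the facets
  that contain it; hence every point of \<open>B\<close> that lies on all facets through \<open>x\<close> is on that
  hyperplane too (\<open>supporting_hyperplane_contains_common_facet_points\<close>).  Every segment that joins
  \<open>z\<close> to a point of the new approximation lies strictly inside the new halfspace, except possibly
  for its far end.  If that far end is outside \<open>B\<close>, the segment leaves \<open>B\<close> before it, hence off the
  hyperplane, and so never again at a point with the same set of facets as \<open>x\<close>.

  This gives a potential that every step decreases: the number of sets of facets at which segments
  from \<open>z\<close> to points of the current approximation outside \<open>B\<close> leave \<open>B\<close>, plus the number of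
  vertices of \<open>B \<inter> S\<close> not yet marked.  With \<open>f\<close> the number of facets, the first summand never
  exceeds \<open>2 ^ f\<close>, and it drops with each cut (\<open>exit_facets_cut\<close>).  The second one starts at the
  number of vertices and drops with each mark, because a vertex of an approximation between
  \<open>B \<inter> S\<close> and \<open>S\<close> that lies in \<open>B\<close> is a vertex of \<open>B \<inter> S\<close>.  When no unmarked vertex is left, the
  approximation is the convex hull of points of \<open>B\<close>, so it is contained in \<open>B\<close>.
\<close>

definition facets_through :: "'a::euclidean_space set \<Rightarrow> 'a \<Rightarrow> 'a set set" where
  "facets_through B x = {F \<in> facets B. x \<in> F}"

text \<open>
  The points \<open>v\<close> range over all of \<open>P\<close>, not just over its vertices, to make the set monotone in \<open>P\<close>:
  a cut creates new vertices, whose exit points need not be exit points for the old ones.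
\<close>
definition exit_facets :: "'a::euclidean_space set \<Rightarrow> 'a \<Rightarrow> 'a set \<Rightarrow> 'a set set set" where
  "exit_facets B z P =
    {facets_through B x | v x. v \<in> P - B \<and> x \<in> closed_segment v z \<inter> frontier B}"

definition oa_potential :: "'a::euclidean_space set \<Rightarrow> 'a set \<Rightarrow> 'a \<Rightarrow> 'a state \<Rightarrow> nat" where
  "oa_potential B S z s =
    card (exit_facets B z (fst s)) + card (vertices (B \<inter> S) - snd s)"

definition oa_invariant :: "'a::euclidean_space set \<Rightarrow> 'a set \<Rightarrow> 'a state \<Rightarrow> bool" where
  "oa_invariant B S s \<longleftrightarrow>
    polytope (fst s) \<and> B \<inter> S \<subseteq> fst s \<and> fst s \<subseteq> S \<and> snd s \<subseteq> B"

section \<open>Supporting halfspaces and facets\<close>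

lemma frontier_halfspace_inner:
  fixes h :: "'a::euclidean_space"
  assumes "h \<noteq> 0"
  shows "frontier {y. y \<bullet> h \<ge> M} = {y. y \<bullet> h = M}"
  using frontier_halfspace_ge[of h M] assms by (simp add: inner_commute)

lemma polyhedron_halfspace: "halfspace H \<Longrightarrow> polyhedron H"
  unfolding halfspace_def using polyhedron_halfspace_ge by (auto simp: inner_commute)

lemma interior_point_strictly_in_halfspace:
  fixes h :: "'a::euclidean_space"
  assumes "h \<noteq> 0" "B \<subseteq> {y. y \<bullet> h \<ge> M}" "z \<in> interior B"
  shows "z \<bullet> h > M"
proof -
  have "B \<subseteq> {y. h \<bullet> y \<ge> M}"
    using assms(2) by (simp add: inner_commute)
  then have "z \<in> interior {y. h \<bullet> y \<ge> M}"
    using assms(3) interior_mono[of B "{y. h \<bullet> y \<ge> M}"] by (meson subsetD)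
  then have "h \<bullet> z > M"
    using assms(1) by simp
  then show ?thesis
    by (simp add: inner_commute)
qed

text \<open>
  The hyperplane cuts out a proper face of \<open>B\<close>, and that face is the intersection of the facets
  containing it; all of these pass through \<open>x\<close>, hence through \<open>y\<close>.
\<close>
lemma supporting_hyperplane_contains_common_facet_points:
  fixes B :: "'a::euclidean_space set"
  assumes "polyhedron B" "interior B \<noteq> {}"
    and "h \<noteq> 0" and B: "B \<subseteq> {y. y \<bullet> h \<ge> M}"
    and x: "x \<in> B" "x \<bullet> h = M"
    and y: "y \<in> B" "facets_through B x \<subseteq> facets_through B y"
  shows "y \<bullet> h = M"
proof -
  define G where "G = B \<inter> {w. h \<bullet> w = M}"
  have "G face_of B"
    unfolding G_def using assms
    by (intro face_of_Int_supporting_hyperplane_ge polyhedron_imp_convex)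
       (auto simp: inner_commute)
  moreover have "x \<in> G"
    using x by (simp add: G_def inner_commute)
  moreover have "G \<noteq> B"
  proof -
    obtain z where z: "z \<in> interior B"
      using assms by blast
    have "z \<in> B" "z \<bullet> h > M"
      using interior_subset z interior_point_strictly_in_halfspace[OF \<open>h \<noteq> 0\<close> B z] by auto
    then show ?thesis
      by (auto simp: G_def inner_commute)
  qed
  ultimately have "G = \<Inter> {F. F facet_of B \<and> G \<subseteq> F}"
    using face_of_polyhedron[OF \<open>polyhedron B\<close>] by blast
  moreover have "y \<in> F" if "F facet_of B" "G \<subseteq> F" for F
    using that y \<open>x \<in> G\<close> by (auto simp: facets_through_def facets_def)
  ultimately have "y \<in> G"
    by blast
  then show ?thesis
    by (simp add: G_def inner_commute)
qed

section \<open>The oracle\<close>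

text \<open>
  The segment from a point outside \<open>B\<close> to \<open>z\<close> meets the boundary of \<open>B\<close> by connectedness, and convexity
  provides a supporting hyperplane there; so the algorithm never gets stuck before it stops.
\<close>
lemma weak_pt_oracle_answers:
  fixes B :: "'a::euclidean_space set"
  assumes "closed B" "convex B" "z \<in> interior B"
  shows "\<exists>a. weak_pt_oracle B z v a"
proof (cases "v \<in> B")
  case True
  then show ?thesis
    using weak_pt_oracle.inside by blast
next
  case False
  have "z \<in> B"
    using assms interior_subset by blast
  then have "closed_segment v z \<inter> frontier B \<noteq> {}"
    using False by (intro connected_Int_frontier) auto
  then obtain x where x: "x \<in> closed_segment v z" "x \<in> frontier B"
    by blast
  have "interior B \<noteq> {}"
    using assms(3) by blast
  then have "rel_interior B = interior B"
    by (rule rel_interior_nonempty_interior)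
  then have "x \<in> B" "x \<notin> rel_interior B"
    using x(2) assms(1) by (simp_all add: frontier_def)
  from supporting_hyperplane_rel_boundary[OF \<open>convex B\<close> this]
  obtain h where h: "h \<noteq> 0" "\<And>y. y \<in> B \<Longrightarrow> h \<bullet> x \<le> h \<bullet> y"
    by metis
  define H where "H = {y. y \<bullet> h \<ge> x \<bullet> h}"
  have "x \<in> frontier H"
    using h by (simp add: H_def frontier_halfspace_inner)
  moreover have "halfspace H"
    using h(1) unfolding halfspace_def H_def by blast
  moreover have "B \<subseteq> H"
    using h(2) by (auto simp: H_def inner_commute)
  ultimately have "supporting_halfspace B H"
    using x(2) by (auto simp: supporting_halfspace_def)
  then show ?thesis
    using weak_pt_oracle.outside[OF False x] \<open>x \<in> frontier H\<close> by blast
qed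

section \<open>The effect of one step\<close>

lemma exit_facets_subset: "exit_facets B z P \<subseteq> Pow (facets B)"
  by (auto simp: exit_facets_def facets_through_def)

lemma exit_facets_mono: "P \<subseteq> Q \<Longrightarrow> exit_facets B z P \<subseteq> exit_facets B z Q"
  by (fastforce simp: exit_facets_def)

lemma finite_facets: "polytope B \<Longrightarrow> finite (facets B)"
  by (simp add: facets_def finite_polytope_facets)

lemma finite_vertices: "polytope P \<Longrightarrow> finite (vertices P)"
  by (simp add: vertices_def finite_polyhedron_extreme_points polytope_imp_polyhedron)

text \<open>
  A point \<open>w\<close> of \<open>P \<inter> H\<close> outside \<open>B\<close> whose exit point \<open>y\<close> had the facets of \<open>x\<close> would have \<open>y\<close> on the
  boundary of \<open>H\<close>; but \<open>y\<close> lies strictly between \<open>w \<in> H\<close> and the interior point \<open>z\<close> of \<open>H\<close>.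
\<close>
lemma exit_facets_cut:
  fixes B :: "'a::euclidean_space set"
  assumes B: "polytope B" "z \<in> interior B"
    and v: "v \<in> P" "weak_pt_oracle B z v (Halfspace H)"
  shows "exit_facets B z (P \<inter> H) \<subset> exit_facets B z P"
proof -
  have B': "polyhedron B" "interior B \<noteq> {}" "closed B"
    using B by (auto simp: polytope_imp_polyhedron polytope_imp_closed)
  obtain x where x: "v \<notin> B" "x \<in> closed_segment v z" "x \<in> frontier B"
      "supporting_halfspace B H" "x \<in> frontier H"
    using v(2) by cases auto
  then obtain h M where h: "h \<noteq> 0" and H: "H = {y. y \<bullet> h \<ge> M}" and BH: "B \<subseteq> {y. y \<bullet> h \<ge> M}"
    by (auto simp: supporting_halfspace_def halfspace_def)
  have xM: "x \<bullet> h = M"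
    using x(5) h by (simp add: H frontier_halfspace_inner)
  have frontier: "y \<in> B" if "y \<in> frontier B" for y
    using that B' by (simp add: frontier_def)
  have "facets_through B x \<in> exit_facets B z P"
    using x v(1) by (auto simp: exit_facets_def)
  moreover have "facets_through B x \<notin> exit_facets B z (P \<inter> H)"
  proof
    assume "facets_through B x \<in> exit_facets B z (P \<inter> H)"
    then obtain w y where wy: "facets_through B x = facets_through B y" "w \<in> H" "w \<notin> B"
        "y \<in> closed_segment w z" "y \<in> frontier B"
      unfolding exit_facets_def by blast
    have "y \<bullet> h = M"
      using supporting_hyperplane_contains_common_facet_points[OF B'(1,2) h BH]
        frontier x(3) xM wy by blast
    obtain t where t: "0 \<le> t" "t \<le> 1" "y = (1 - t) *\<^sub>R w + t *\<^sub>R z"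
      using wy(4) by (auto simp: closed_segment_def)
    \<comment> \<open>\<open>t = 0\<close> would make the boundary point \<open>y\<close> of \<open>B\<close> equal to \<open>w\<close>, which is outside \<open>B\<close>.\<close>
    have "t \<noteq> 0"
      using t(3) wy(3,5) frontier by auto
    then have "t * (z \<bullet> h) > t * M"
      using t(1) interior_point_strictly_in_halfspace[OF h BH B(2)] by simp
    moreover have "(1 - t) * (w \<bullet> h) \<ge> (1 - t) * M"
      using t(2) wy(2) by (simp add: H mult_left_mono)
    moreover have "y \<bullet> h = (1 - t) * (w \<bullet> h) + t * (z \<bullet> h)"
      by (simp add: t(3) inner_add_left)
    ultimately show False
      using \<open>y \<bullet> h = M\<close> by (simp add: algebra_simps)
  qed
  ultimately show ?thesis
    using exit_facets_mono[of "P \<inter> H" P] by blast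
qed

lemma oa_invariant_step:
  assumes "oa_invariant B S s" "oa_step B z s t"
  shows "oa_invariant B S t"
  using assms(2)
proof cases
  case (mark v P F)
  moreover have "v \<in> B"
    using mark(5) by cases auto
  ultimately show ?thesis
    using assms(1) by (auto simp: oa_invariant_def)
next
  case (cut v P F H)
  have "supporting_halfspace B H"
    using cut(5) by cases auto
  then have "halfspace H" "B \<subseteq> H"
    by (simp_all add: supporting_halfspace_def)
  moreover have "polytope (P \<inter> H)"
    using assms(1) cut(1) polytope_Int_polyhedron[OF _ polyhedron_halfspace[OF \<open>halfspace H\<close>]]
    by (simp add: oa_invariant_def)
  ultimately show ?thesis
    using assms(1) cut(1,2) by (auto simp: oa_invariant_def)
qed

text \<open>
  Each kind of step lowers its own summand: a mark leaves the approximation alone, and a cut leaves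
  the marks alone.
\<close>
lemma oa_potential_step:
  fixes B :: "'a::euclidean_space set"
  assumes B: "polytope B" "z \<in> interior B" and S: "polytope S"
    and inv: "oa_invariant B S s" and step: "oa_step B z s t"
  shows "oa_potential B S z t < oa_potential B S z s"
  using step
proof cases
  case (mark v P F)
  have "v \<in> B"
    using mark(5) by cases auto
  \<comment> \<open>An extreme point of \<open>P\<close> stays extreme in every subset of \<open>P\<close> that contains it.\<close>
  then have "v \<in> vertices (B \<inter> S)"
    using mark inv unfolding oa_invariant_def vertices_def extreme_point_of_def by auto
  then have "vertices (B \<inter> S) - insert v F \<subset> vertices (B \<inter> S) - F"
    using mark(4) by blast
  then have "card (vertices (B \<inter> S) - insert v F) < card (vertices (B \<inter> S) - F)"
    using B S by (intro psubset_card_mono) (auto simp: finite_vertices polytope_Int)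
  then show ?thesis
    by (simp add: oa_potential_def mark)
next
  case (cut v P F H)
  have "v \<in> P"
    using cut(3) by (simp add: vertices_def extreme_point_of_def)
  moreover have "finite (exit_facets B z P)"
    using finite_subset[OF exit_facets_subset] finite_facets[OF B(1)] by blast
  ultimately have "card (exit_facets B z (P \<inter> H)) < card (exit_facets B z P)"
    using exit_facets_cut[OF B _ cut(5)] by (simp add: psubset_card_mono)
  then show ?thesis
    by (simp add: oa_potential_def cut)
qed

section \<open>Runs of the algorithm\<close>

lemma oa_run_potential:
  fixes B :: "'a::euclidean_space set"
  assumes "polytope B" "z \<in> interior B" "polytope S"
    and "(oa_step B z ^^ n) (oa_init S) s"
  shows "oa_invariant B S s \<and>
    n + oa_potential B S z s \<le> oa_potential B S z (oa_init S)"
  using assms(4)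
proof (induction n arbitrary: s)
  case 0
  then show ?case
    using assms by (auto simp: oa_invariant_def oa_init_def)
next
  case (Suc n)
  then obtain u where u: "(oa_step B z ^^ n) (oa_init S) u" "oa_step B z u s"
    by auto
  then show ?case
    using Suc.IH[OF u(1)] oa_invariant_step[OF _ u(2)] oa_potential_step[OF assms(1-3) _ u(2)]
    by fastforce
qed

lemma oa_potential_init:
  fixes B :: "'a::euclidean_space set"
  assumes "polytope B"
  shows "oa_potential B S z (oa_init S) \<le> card (vertices (B \<inter> S)) + 2 ^ card (facets B)"
proof -
  have "card (exit_facets B z S) \<le> card (Pow (facets B))"
    using finite_facets[OF assms] by (intro card_mono exit_facets_subset) simp
  then show ?thesis
    using finite_facets[OF assms] by (simp add: oa_potential_def oa_init_def card_Pow)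
qed

text \<open>By Krein-Milman the approximation is the convex hull of its vertices, all of them in \<open>B\<close>.\<close>
lemma oa_stopped_result:
  assumes "convex B" "oa_invariant B S s" "oa_stopped s"
  shows "fst s = B \<inter> S"
proof -
  have "vertices (fst s) \<subseteq> B"
    using assms by (auto simp: oa_invariant_def oa_stopped_def)
  moreover have "fst s = convex hull vertices (fst s)"
    unfolding vertices_def using assms
    by (intro Krein_Milman_Minkowski)
       (auto simp: oa_invariant_def polytope_imp_compact polytope_imp_convex)
  ultimately have "fst s \<subseteq> B"
    using assms(1) hull_minimal by metis
  then show ?thesis
    using assms(2) by (auto simp: oa_invariant_def)
qed

lemma oa_progress:
  fixes B :: "'a::euclidean_space set"
  assumes "closed B" "convex B" "z \<in> interior B" "\<not> oa_stopped s"
  shows "\<exists>t. oa_step B z s t"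
proof -
  obtain v where v: "v \<in> vertices (fst s)" "v \<notin> snd s"
    using assms by (auto simp: oa_stopped_def)
  obtain a where "weak_pt_oracle B z v a"
    using weak_pt_oracle_answers assms by blast
  then show ?thesis
    using v by (cases a; cases s) (auto intro: oa_step.intros)
qed

theorem theorem6:
  fixes S B :: "(real ^ 'p) set" and z :: "real ^ 'p"
  assumes "polytope S" and "interior S \<noteq> {}"
    and "polytope B" and "interior B \<noteq> {}"
    and "z \<in> interior B"
  shows "(\<nexists>r. r 0 = oa_init S \<and> (\<forall>i::nat. oa_step B z (r i) (r (Suc i)))) \<and>
    (\<forall>s. (oa_step B z)\<^sup>*\<^sup>* (oa_init S) s \<longrightarrow> oa_stopped s \<or> (\<exists>t. oa_step B z s t)) \<and>
    (\<forall>s. (oa_step B z)\<^sup>*\<^sup>* (oa_init S) s \<and> oa_stopped s \<longrightarrow> fst s = B \<inter> S) \<and>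
    (\<forall>n s. (oa_step B z ^^ n) (oa_init S) s \<longrightarrow>
       n \<le> card (vertices (B \<inter> S)) + 2 ^ card (facets B))"
proof -
  let ?N = "card (vertices (B \<inter> S)) + 2 ^ card (facets B)"
  have B: "closed B" "convex B"
    using assms by (auto simp: polytope_imp_closed polytope_imp_convex)
  note run = oa_run_potential[OF \<open>polytope B\<close> \<open>z \<in> interior B\<close> \<open>polytope S\<close>]
  have bound: "n \<le> ?N" if "(oa_step B z ^^ n) (oa_init S) s" for n s
    using run[OF that] oa_potential_init[OF \<open>polytope B\<close>, of S z] by linarith
  have finite_runs: "\<not> (\<forall>i. oa_step B z (r i) (r (Suc i)))" if "r 0 = oa_init S" for r
  proof
    assume r: "\<forall>i. oa_step B z (r i) (r (Suc i))"
    have "(oa_step B z ^^ n) (oa_init S) (r n)" for n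
    proof (induction n)
      case 0
      show ?case
        using that by simp
    next
      case (Suc n)
      then show ?case
        using relpowp_Suc_I r by metis
    qed
    from bound[OF this[of "Suc ?N"]] show False
      by simp
  qed
  have result: "fst s = B \<inter> S"
    if reach: "(oa_step B z)\<^sup>*\<^sup>* (oa_init S) s" and stop: "oa_stopped s" for s
  proof -
    obtain n where "(oa_step B z ^^ n) (oa_init S) s"
      using rtranclp_imp_relpowp[OF reach] by blast
    then have "oa_invariant B S s"
      using run by simp
    then show ?thesis
      using oa_stopped_result[OF B(2)] stop by simp
  qed
  have progress: "oa_stopped s \<or> (\<exists>t. oa_step B z s t)" for s
    using oa_progress[OF B \<open>z \<in> interior B\<close>] by blast
  show ?thesis
  proof (intro conjI allI impI)
    show "\<nexists>r. r 0 = oa_init S \<and> (\<forall>i. oa_step B z (r i) (r (Suc i)))"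
      using finite_runs by metis
  qed (use result progress bound in simp_all)
qed

end
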